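(* Let $\nu\in\mathbb R$. The set of $j_\nu$-Liouville numbers is uncountable and dense in $\mathbb R$.
   Context: The normalized Bessel function of order $\nu$ is the even entire function $j_\nu(z)=\sum_{k=0}^\infty \frac{(-1)^k}{k!\,\Gamma(k+\nu+1)}(z/2)^{2k}$, with $1/\Gamma=0$ at nonpositive integers (equal to $(z/2)^{-\nu}J_\nu(z)$). A nonzero complex number $z$ is $j_\nu$-rational if $z=a/b$ with $a,b$ zeros of $j_\nu$ in $\mathbb C$ and $b\ne0$. A complex number $z$ is $j_\nu$-Liouville if (i) $z$ is not $j_\nu$-rational, and (ii) for every $N\in\mathbb N$ there are zeros $a,b$ of $j_\nu$ with $|b|>1$ such that $|z-a/b|<1/|b|^N$. All $j_\nu$-Liouville numbers are real. *)

theory Defs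
  imports "HOL-Analysis.Analysis"
begin

(* rGamma is the entire function 1/Gamma, vanishing at the nonpositive integers. *)
definition bessel_j :: "real \<Rightarrow> complex \<Rightarrow> complex" where
  "bessel_j \<nu> z =
     (\<Sum>k. (-1) ^ k / fact k * rGamma (of_nat k + of_real \<nu> + 1) * (z / 2) ^ (2 * k))"

definition bessel_zeros :: "real \<Rightarrow> complex set" where
  "bessel_zeros \<nu> = {z. bessel_j \<nu> z = 0}"

(* If \<nu> is a negative integer then 0 is a zero of bessel_j \<nu>; the condition z \<noteq> 0
   keeps 0 from counting as rational in that case. *)
definition bessel_rational :: "real \<Rightarrow> complex \<Rightarrow> bool" where
  "bessel_rational \<nu> z \<longleftrightarrow>
     z \<noteq> 0 \<and> (\<exists>a\<in>bessel_zeros \<nu>. \<exists>b\<in>bessel_zeros \<nu>. b \<noteq> 0 \<and> z = a / b)"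

definition bessel_Liouville :: "real \<Rightarrow> complex \<Rightarrow> bool" where
  "bessel_Liouville \<nu> z \<longleftrightarrow>
     \<not> bessel_rational \<nu> z \<and>
     (\<forall>N::nat. \<exists>a\<in>bessel_zeros \<nu>. \<exists>b\<in>bessel_zeros \<nu>.
        norm b > 1 \<and> norm (z - a / b) < 1 / norm b ^ N)"

(* Every complex number satisfying bessel_Liouville is real, so no Liouville number is
   lost by taking the set inside the reals; density in the real line is then
   literally closure = UNIV. *)
definition bessel_Liouville_numbers :: "real \<Rightarrow> real set" where
  "bessel_Liouville_numbers \<nu> = {x. bessel_Liouville \<nu> (complex_of_real x)}"

end

theory Submission
  imports Defs "HOL-Complex_Analysis.Complex_Analysis"
begin

text \<open>
  On the positive half-line \<open>u(x) = x\<^bsup>\<nu>+1/2\<^esup> j\<^sub>\<nu>(x)\<close> solves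
  \<open>u'' + (1 - (\<nu>\<^sup>2 - 1/4)/x\<^sup>2) u = 0\<close>, so by Sturm comparison with \<open>sin (x/2)\<close> every interval
  \<open>[x, x + 2\<pi>]\<close> with \<open>x\<close> large contains a zero of \<open>j\<^sub>\<nu>\<close>. Hence the quotients \<open>a/b\<close> of real zeros
  with \<open>\<bar>b\<bar> > 1\<close> are dense in the real line, and condition (ii) in the definition of a Liouville
  number describes a dense \<open>G\<^sub>\<delta>\<close> set of reals. The zeros of the entire function \<open>j\<^sub>\<nu>\<close> are countable,
  so by Baire's theorem the set stays dense after removing the \<open>j\<^sub>\<nu>\<close>-rational numbers together with
  any further countable set.
\<close>

section \<open>The power series\<close>

text \<open>Taylor coefficients of j_\<nu>(z) in the variable y = z^2. They are kept real so that
  one sequence serves both the complex series and its real restriction.\<close>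

definition bessel_coeff :: "real \<Rightarrow> nat \<Rightarrow> real" where
  "bessel_coeff \<nu> k = (-1) ^ k / fact k * rGamma (of_nat k + \<nu> + 1) / 4 ^ k"

text \<open>The functional equation of \<open>rGamma\<close> relates consecutive coefficients.
  Written without division, it also covers k + 1 + \<nu> = 0, where the coefficient of index k must
  vanish.\<close>

lemma bessel_coeff_Suc:
  "4 * (real k + 1) * (real k + 1 + \<nu>) * bessel_coeff \<nu> (Suc k) = - bessel_coeff \<nu> k"
proof -
  have "(real k + \<nu> + 1) * rGamma (real k + \<nu> + 1 + 1) = rGamma (real k + \<nu> + 1)"
    by (rule rGamma_plus1)
  moreover have "real (Suc k) + \<nu> + 1 = real k + \<nu> + 1 + 1"
    by simp
  ultimately have *: "rGamma (real k + \<nu> + 1) = (real k + 1 + \<nu>) * rGamma (real (Suc k) + \<nu> + 1)"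
    by (simp add: add_ac)
  have "(fact (Suc k) :: real) = (real k + 1) * fact k"
    by simp
  then show ?thesis
    unfolding bessel_coeff_def * by (simp add: divide_simps del: of_nat_Suc fact_Suc)
qed

lemma bessel_coeff_nonzero:
  assumes "real k + \<nu> + 1 > 0"
  shows "bessel_coeff \<nu> k \<noteq> 0"
  using assms unfolding bessel_coeff_def
  by (auto simp: rGamma_eq_zero_iff elim!: nonpos_Ints_cases)

lemma summable_bessel_coeff:
  fixes y :: "'a :: {real_normed_field, banach}"
  shows "summable (\<lambda>k. of_real (bessel_coeff \<nu> k) * y ^ k)"
\<comment> \<open>From this index on, k is at least \<open>norm y\<close> and k + \<nu> is
  nonnegative, so by the recurrence each term is at most half the preceding one.\<close>
proof (rule summable_ratio_test[where c = "1/2" and N = "nat \<lceil>norm y + \<bar>\<nu>\<bar>\<rceil>"])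
  fix k
  assume "nat \<lceil>norm y + \<bar>\<nu>\<bar>\<rceil> \<le> k"
  then have k: "norm y + \<bar>\<nu>\<bar> \<le> real k"
    by linarith
  have le: "norm y \<le> real k" "0 \<le> real k + \<nu>"
    using k norm_ge_zero[of y] by linarith+
  then have "norm y * 2 \<le> 4 * (real k + 1) * 1"
    using norm_ge_zero[of y] by simp
  also have "\<dots> \<le> 4 * (real k + 1) * (real k + 1 + \<nu>)"
    using le by (intro mult_left_mono) auto
  finally have "norm y * 2 * \<bar>bessel_coeff \<nu> (Suc k)\<bar>
      \<le> 4 * (real k + 1) * (real k + 1 + \<nu>) * \<bar>bessel_coeff \<nu> (Suc k)\<bar>"
    by (intro mult_right_mono) auto
  also have "\<dots> = \<bar>4 * (real k + 1) * (real k + 1 + \<nu>) * bessel_coeff \<nu> (Suc k)\<bar>"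
    using le by (simp add: abs_mult)
  also have "\<dots> = \<bar>bessel_coeff \<nu> k\<bar>"
    by (simp only: bessel_coeff_Suc abs_minus_cancel)
  finally have "norm y * 2 * \<bar>bessel_coeff \<nu> (Suc k)\<bar> * norm y ^ k \<le> \<bar>bessel_coeff \<nu> k\<bar> * norm y ^ k"
    by (intro mult_right_mono) auto
  then show "norm (of_real (bessel_coeff \<nu> (Suc k)) * y ^ Suc k)
      \<le> 1 / 2 * norm (of_real (bessel_coeff \<nu> k) * y ^ k)"
    by (simp add: norm_mult norm_power mult_ac)
qed simp

definition bessel_h :: "real \<Rightarrow> 'a :: {real_normed_field, banach} \<Rightarrow> 'a" where
  "bessel_h \<nu> y = (\<Sum>k. of_real (bessel_coeff \<nu> k) * y ^ k)"

lemma bessel_j_eq: "bessel_j \<nu> z = bessel_h \<nu> (z\<^sup>2)"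
proof -
  have rG: "rGamma (of_nat k + of_real \<nu> + 1 :: complex) = of_real (rGamma (real k + \<nu> + 1))" for k
    by (subst rGamma_complex_of_real[symmetric]) simp
  have "(-1) ^ k / fact k * rGamma (of_nat k + of_real \<nu> + 1) * (z / 2) ^ (2 * k)
      = of_real (bessel_coeff \<nu> k) * (z\<^sup>2) ^ k" for k
    unfolding bessel_coeff_def rG by (simp add: power_divide power_mult)
  then show ?thesis
    unfolding bessel_j_def bessel_h_def by simp
qed

lemma bessel_h_of_real: "bessel_h \<nu> (complex_of_real x) = of_real (bessel_h \<nu> x)"
  using suminf_of_real[OF summable_bessel_coeff[where y = x and \<nu> = \<nu>], where 'a = complex]
  unfolding bessel_h_def by simp

lemma bessel_h_has_field_derivative:
  "(bessel_h \<nu> has_field_derivative (\<Sum>k. diffs (\<lambda>k. of_real (bessel_coeff \<nu> k)) k * y ^ k)) (at y)"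
  using termdiffs_strong_converges_everywhere[OF summable_bessel_coeff]
  unfolding bessel_h_def[abs_def] by blast

text \<open>This is Bessel's equation rewritten in y = z^2; comparing the coefficients of y^k
  reduces it to \<open>bessel_coeff_Suc\<close>.\<close>

lemma bessel_h_ode:
  obtains h' h'' :: "real \<Rightarrow> real" where
    "\<And>y. (bessel_h \<nu> has_field_derivative h' y) (at y)"
    "\<And>y. (h' has_field_derivative h'' y) (at y)"
    "\<And>y. 4 * y * h'' y + 4 * (1 + \<nu>) * h' y + bessel_h \<nu> y = 0"
proof
  let ?c = "bessel_coeff \<nu>"
  let ?h' = "\<lambda>y. \<Sum>k. diffs ?c k * y ^ k"
  let ?h'' = "\<lambda>y. \<Sum>k. diffs (diffs ?c) k * y ^ k"
  have s0: "summable (\<lambda>k. ?c k * y ^ k)" for y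
    using summable_bessel_coeff[of \<nu> y] by simp
  have s1: "summable (\<lambda>k. diffs ?c k * y ^ k)" for y
    by (rule termdiff_converges_all[OF s0])
  have s2: "summable (\<lambda>k. diffs (diffs ?c) k * y ^ k)" for y
    by (rule termdiff_converges_all[OF s1])
  show "(bessel_h \<nu> has_field_derivative ?h' y) (at y)" for y
    using bessel_h_has_field_derivative[of \<nu> y] by simp
  show "(?h' has_field_derivative ?h'' y) (at y)" for y
    by (rule termdiffs_strong_converges_everywhere[OF s1])
  fix y :: real
  have "(\<lambda>k. y * (of_nat k * diffs ?c k * y ^ (k - Suc 0))) sums (y * ?h'' y)"
    by (intro sums_mult diffs_equiv s2)
  \<comment> \<open>At k = 0 the truncated exponent does no harm, because the factor k
    vanishes.\<close>
  moreover have "y * (of_nat k * diffs ?c k * y ^ (k - Suc 0)) = of_nat k * diffs ?c k * y ^ k" for k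
    by (cases k) auto
  ultimately have "(\<lambda>k. of_nat k * diffs ?c k * y ^ k) sums (y * ?h'' y)"
    by simp
  then have "(\<lambda>k. 4 * (of_nat k * diffs ?c k * y ^ k) + 4 * (1 + \<nu>) * (diffs ?c k * y ^ k) + ?c k * y ^ k)
      sums (4 * (y * ?h'' y) + 4 * (1 + \<nu>) * ?h' y + (\<Sum>k. ?c k * y ^ k))"
    by (intro sums_add sums_mult summable_sums s0 s1)
  moreover have "4 * (of_nat k * diffs ?c k * y ^ k) + 4 * (1 + \<nu>) * (diffs ?c k * y ^ k) + ?c k * y ^ k = 0"
    for k
  proof -
    have "4 * (of_nat k * diffs ?c k * y ^ k) + 4 * (1 + \<nu>) * (diffs ?c k * y ^ k) + ?c k * y ^ k
        = (4 * (real k + 1) * (real k + 1 + \<nu>) * ?c (Suc k) + ?c k) * y ^ k"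
      unfolding diffs_def by (simp add: algebra_simps)
    then show ?thesis
      unfolding bessel_coeff_Suc by simp
  qed
  ultimately have "(\<lambda>_. 0) sums (4 * (y * ?h'' y) + 4 * (1 + \<nu>) * ?h' y + (\<Sum>k. ?c k * y ^ k))"
    by (simp only:)
  then have "4 * (y * ?h'' y) + 4 * (1 + \<nu>) * ?h' y + (\<Sum>k. ?c k * y ^ k) = 0"
    using sums_zero by (rule sums_unique2)
  then show "4 * y * ?h'' y + 4 * (1 + \<nu>) * ?h' y + bessel_h \<nu> y = 0"
    by (simp add: bessel_h_def mult.assoc)
qed

section \<open>Countability of the zeros\<close>

lemma bessel_h_neq_0: "bessel_h \<nu> \<noteq> (\<lambda>_ :: complex. 0)"
proof
  let ?c = "\<lambda>k. complex_of_real (bessel_coeff \<nu> k)"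
  assume "bessel_h \<nu> = (\<lambda>_ :: complex. 0)"
  then have "(\<Sum>k. ?c k * y ^ k) = 0" for y
    unfolding bessel_h_def by metis
  then have sums: "(\<lambda>k. ?c k * (y - 0) ^ k) sums (\<lambda>_. 0) y" for y
    using summable_sums[OF summable_bessel_coeff[of \<nu> y]] by simp
  \<comment> \<open>For a negative integer \<nu> the initial coefficients vanish; this index lies
    beyond them. It must be positive because \<open>powser_0_nonzero\<close> is applied to a
    function with value 0 at the centre.\<close>
  define m where "m = Suc (nat \<lceil>\<bar>\<nu>\<bar>\<rceil>)"
  have "real m + \<nu> + 1 > 0"
    unfolding m_def by linarith
  then have "?c m \<noteq> 0"
    using bessel_coeff_nonzero by simp
  moreover have "m > 0"
    by (simp add: m_def)
  ultimately obtain s where s: "0 < s"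
    "\<And>z :: complex. z \<in> cball 0 s - {0} \<Longrightarrow> (\<lambda>_. 0 :: complex) z \<noteq> 0"
    using powser_0_nonzero[of 1 0 ?c "\<lambda>_. 0" m, OF zero_less_one sums refl] by metis
  then show False
    using s(2)[of "of_real s"] by simp
qed

text \<open>An entire function with uncountably many zeros is identically zero. Since every complex
  number is a square, \<open>bessel_h\<close> would then vanish everywhere as well.\<close>

lemma countable_bessel_zeros: "countable (bessel_zeros \<nu>)"
proof (rule ccontr)
  assume "uncountable (bessel_zeros \<nu>)"
  moreover have "bessel_h \<nu> holomorphic_on (UNIV :: complex set)"
    using bessel_h_has_field_derivative holomorphic_on_open by blast
  then have "(bessel_h \<nu> \<circ> (\<lambda>z. z\<^sup>2)) holomorphic_on (UNIV :: complex set)"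
    by (intro holomorphic_on_compose[OF _ holomorphic_on_subset] holomorphic_intros) auto
  then have "bessel_j \<nu> holomorphic_on UNIV"
    by (simp add: bessel_j_eq[abs_def] o_def)
  ultimately have "bessel_j \<nu> = (\<lambda>_. 0)"
    unfolding bessel_zeros_def by (intro holomorphic_countable_equal_UNIV) auto
  then have "bessel_h \<nu> y = 0" for y :: complex
    using bessel_j_eq[of \<nu> "csqrt y"] by simp
  then show False
    using bessel_h_neq_0 by blast
qed

lemma countable_bessel_rational: "countable {x. bessel_rational \<nu> (of_real x)}"
proof -
  have "complex_of_real ` {x. bessel_rational \<nu> (of_real x)}
      \<subseteq> (\<lambda>(a, b). a / b) ` (bessel_zeros \<nu> \<times> bessel_zeros \<nu>)"
    unfolding bessel_rational_def by auto
  then have "countable (complex_of_real ` {x. bessel_rational \<nu> (of_real x)})"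
    by (rule countable_subset) (intro countable_image countable_SIGMA countable_bessel_zeros)
  then show ?thesis
    by (rule countable_image_inj_on) (simp add: inj_on_def)
qed

section \<open>Sturm comparison\<close>

text \<open>The Wronskian of \<open>u\<close> and \<open>sin (m (x - c))\<close> would be nonincreasing, yet has the sign
  of \<open>- u\<close> at \<open>c\<close> and of \<open>u\<close> at \<open>c + \<pi>/m\<close>.\<close>

lemma Sturm_comparison_pos:
  fixes u u' q :: "real \<Rightarrow> real"
  assumes "m > 0"
    and u: "\<And>x. c \<le> x \<Longrightarrow> x \<le> c + pi / m \<Longrightarrow> (u has_field_derivative u' x) (at x)"
    and u': "\<And>x. c \<le> x \<Longrightarrow> x \<le> c + pi / m \<Longrightarrow> (u' has_field_derivative - q x * u x) (at x)"
    and q: "\<And>x. c \<le> x \<Longrightarrow> x \<le> c + pi / m \<Longrightarrow> m\<^sup>2 \<le> q x"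
    and pos: "\<And>x. c \<le> x \<Longrightarrow> x \<le> c + pi / m \<Longrightarrow> u x > 0"
  shows False
proof -
  define W where "W x = u' x * sin (m * (x - c)) - u x * (m * cos (m * (x - c)))" for x
  have le: "c \<le> c + pi / m"
    using \<open>m > 0\<close> by simp
  have "W (c + pi / m) \<le> W c"
  proof (rule DERIV_nonpos_imp_nonincreasing[OF le])
    fix x
    assume x: "c \<le> x" "x \<le> c + pi / m"
    have "(W has_field_derivative (m\<^sup>2 - q x) * (u x * sin (m * (x - c)))) (at x)"
      unfolding W_def
      by (rule derivative_eq_intros u[OF x] u'[OF x] refl)+
        (simp add: algebra_simps power2_eq_square)
    moreover have "sin (m * (x - c)) \<ge> 0"
      using x \<open>m > 0\<close> by (intro sin_ge_zero) (auto simp: field_simps)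
    then have "(m\<^sup>2 - q x) * (u x * sin (m * (x - c))) \<le> 0"
      using q[OF x] pos[OF x] by (intro mult_nonpos_nonneg mult_nonneg_nonneg) auto
    ultimately show "\<exists>y. DERIV W x :> y \<and> y \<le> 0"
      by blast
  qed
  moreover have "W c = - m * u c" "W (c + pi / m) = m * u (c + pi / m)"
    using \<open>m > 0\<close> by (auto simp: W_def)
  ultimately have "m * (u (c + pi / m) + u c) \<le> 0"
    by (simp add: algebra_simps)
  then show False
    using \<open>m > 0\<close> pos[of c] pos[of "c + pi / m"] le by (simp add: mult_le_0_iff)
qed

text \<open>A continuous function without zeros on an interval has constant sign there; the negative
  case reduces to the positive one through \<open>- u\<close>, which solves the same linear
  equation.\<close>

lemma Sturm_comparison:
  fixes u u' q :: "real \<Rightarrow> real"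
  assumes "m > 0"
    and u: "\<And>x. c \<le> x \<Longrightarrow> x \<le> c + pi / m \<Longrightarrow> (u has_field_derivative u' x) (at x)"
    and u': "\<And>x. c \<le> x \<Longrightarrow> x \<le> c + pi / m \<Longrightarrow> (u' has_field_derivative - q x * u x) (at x)"
    and q: "\<And>x. c \<le> x \<Longrightarrow> x \<le> c + pi / m \<Longrightarrow> m\<^sup>2 \<le> q x"
  shows "\<exists>x\<in>{c..c + pi / m}. u x = 0"
proof (rule ccontr)
  assume "\<not> ?thesis"
  then have nz: "u x \<noteq> 0" if "x \<in> {c..c + pi / m}" for x
    using that by blast
  have "connected (u ` {c..c + pi / m})"
    using u by (intro connected_continuous_image)
      (auto intro!: continuous_at_imp_continuous_on DERIV_isCont)
  moreover have "0 \<notin> u ` {c..c + pi / m}"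
    using nz by force
  ultimately have "(\<forall>x\<in>{c..c + pi / m}. u x > 0) \<or> (\<forall>x\<in>{c..c + pi / m}. u x < 0)"
    using connectedD_interval[of "u ` {c..c + pi / m}" _ _ 0] by (meson image_eqI not_less)
  then show False
  proof
    assume "\<forall>x\<in>{c..c + pi / m}. u x > 0"
    then show False
      using Sturm_comparison_pos[of m c u u' q] assms by auto
  next
    assume neg: "\<forall>x\<in>{c..c + pi / m}. u x < 0"
    show False
    proof (rule Sturm_comparison_pos[of m c "\<lambda>x. - u x" "\<lambda>x. - u' x" q])
      fix x
      assume x: "c \<le> x" "x \<le> c + pi / m"
      show "((\<lambda>x. - u x) has_field_derivative - u' x) (at x)"
        by (intro DERIV_minus u x)
      show "((\<lambda>x. - u' x) has_field_derivative - q x * - u x) (at x)"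
        using DERIV_minus[OF u'[OF x]] by simp
      show "m\<^sup>2 \<le> q x" "- u x > 0"
        using q x neg by auto
    qed fact
  qed
qed

lemma bessel_h_square_zero:
  obtains X where "X > 0"
    "\<And>c. X \<le> c \<Longrightarrow> \<exists>x\<in>{c..c + 2 * pi}. bessel_h \<nu> (x\<^sup>2) = (0 :: real)"
proof
  \<comment> \<open>This exponent removes the first-order term: f'' + (2s/x) f' + f = 0 becomes u''
    + (1 - s(s-1)/x^2) u = 0 for u = x^s f, and s(s-1) = \<nu>^2 - 1/4.\<close>
  define s where "s = \<nu> + 1/2"
  \<comment> \<open>For x \<ge> X the quotient s(s-1)/x^2 is at most 1/2, so \<open>q x\<close> is
    at least 1/4. The summand 1 ensures x \<ge> 1, hence x \<le> x^2.\<close>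
  define X where "X = \<bar>2 * s * (s - 1)\<bar> + 1"
  show "X > 0"
    unfolding X_def by linarith
  obtain h' h'' :: "real \<Rightarrow> real" where
    h: "\<And>y. (bessel_h \<nu> has_field_derivative h' y) (at y)" and
    h': "\<And>y. (h' has_field_derivative h'' y) (at y)" and
    ode: "\<And>y. 4 * y * h'' y + 4 * (1 + \<nu>) * h' y + bessel_h \<nu> y = 0"
    by (rule bessel_h_ode[of \<nu>]) blast
  define f where "f x = bessel_h \<nu> (x\<^sup>2)" for x :: real
  define f' where "f' x = 2 * x * h' (x\<^sup>2)" for x
  define f'' where "f'' x = 2 * h' (x\<^sup>2) + 4 * x\<^sup>2 * h'' (x\<^sup>2)" for x
  have sq: "((\<lambda>x. x\<^sup>2) has_field_derivative 2 * x) (at x)" for x :: real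
    by (auto intro!: derivative_eq_intros)
  have f: "(f has_field_derivative f' x) (at x)" for x
    using DERIV_chain2[OF h sq[of x]] by (simp add: f_def[abs_def] f'_def mult.commute)
  have h'_sq: "((\<lambda>x. h' (x\<^sup>2)) has_field_derivative h'' (x\<^sup>2) * (2 * x)) (at x)" for x
    by (rule DERIV_chain2[OF h' sq])
  have f': "(f' has_field_derivative f'' x) (at x)" for x
    unfolding f'_def f''_def
    by (rule derivative_eq_intros h'_sq refl)+ (simp add: power2_eq_square)
  have f_ode: "x * f'' x = - 2 * s * f' x - x * f x" for x
  proof -
    have "x * f'' x + 2 * s * f' x + x * f x
        = x * (4 * x\<^sup>2 * h'' (x\<^sup>2) + 4 * (1 + \<nu>) * h' (x\<^sup>2) + bessel_h \<nu> (x\<^sup>2))"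
      unfolding f_def f'_def f''_def s_def by (simp add: algebra_simps)
    also have "\<dots> = 0"
      unfolding ode by simp
    finally show ?thesis by simp
  qed
  define u where "u x = x powr s * f x" for x
  define u' where "u' x = x powr s * f' x + s * x powr (s - 1) * f x" for x
  define q where "q x = 1 - s * (s - 1) / x\<^sup>2" for x
  have u: "(u has_field_derivative u' x) (at x)" if "x > 0" for x
    unfolding u_def u'_def using that
    by (auto intro!: derivative_eq_intros f simp: algebra_simps)
  have u': "(u' has_field_derivative - q x * u x) (at x)" if x: "x > 0" for x
  proof -
    \<comment> \<open>With \<open>x powr (s - 2)\<close> factored out of every term, only a rational
      identity in x remains.\<close>
    have e1: "x powr (s - 1) = x powr (s - 2) * x" and e2: "x powr s = x powr (s - 2) * x\<^sup>2"
      using x by (simp_all add: powr_diff power2_eq_square)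
    have "(u' has_field_derivative
        x powr s * f'' x + 2 * s * x powr (s - 1) * f' x + s * (s - 1) * x powr (s - 2) * f x) (at x)"
      unfolding u'_def using x
      by (auto intro!: derivative_eq_intros f f' simp: algebra_simps)
    moreover have "x powr s * f'' x + 2 * s * x powr (s - 1) * f' x + s * (s - 1) * x powr (s - 2) * f x
        = x powr (s - 2) * (x * (x * f'' x) + 2 * s * x * f' x + s * (s - 1) * f x)"
      unfolding e1 e2 by (simp add: algebra_simps power2_eq_square)
    moreover have "\<dots> = - q x * u x"
      unfolding f_ode u_def q_def e2 using x by (simp add: field_simps power2_eq_square)
    ultimately show ?thesis
      by simp
  qed
  have q: "(1/2)\<^sup>2 \<le> q x" if "X \<le> x" for x
  proof -
    have "1 \<le> x" "\<bar>2 * s * (s - 1)\<bar> \<le> x"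
      using that unfolding X_def by linarith+
    then have "s * (s - 1) * 2 \<le> x * x"
      using mult_left_mono[of 1 x x] by linarith
    then have "s * (s - 1) / x\<^sup>2 \<le> 1/2"
      using \<open>1 \<le> x\<close> by (simp add: divide_le_eq power2_eq_square)
    moreover have "(1/2)\<^sup>2 = (1/4 :: real)"
      by (simp add: power2_eq_square)
    ultimately show ?thesis
      unfolding q_def by linarith
  qed
  fix c
  assume "X \<le> c"
  with \<open>X > 0\<close> have "c > 0"
    by linarith
  \<comment> \<open>Comparison with sin((x - c)/2), whose consecutive zeros are 2 pi apart. A zero
    of u is a zero of f, as x^s is nonzero for x > 0.\<close>
  have "\<exists>x\<in>{c..c + pi / (1/2)}. u x = 0"
    by (rule Sturm_comparison[where u' = u' and q = q])
      (use u u' q \<open>X \<le> c\<close> \<open>c > 0\<close> in auto)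
  then obtain x where "c \<le> x" "x \<le> c + 2 * pi" "u x = 0"
    by auto
  then show "\<exists>x\<in>{c..c + 2 * pi}. bessel_h \<nu> (x\<^sup>2) = (0 :: real)"
    using \<open>c > 0\<close> unfolding u_def f_def by (intro bexI[of _ x]) auto
qed

section \<open>Well approximable numbers\<close>

text \<open>Gaps of bounded length in Z become arbitrarily small after division by a large element b
  of Z, so some a in Z makes a / b close to t.\<close>

lemma dense_quotients:
  fixes Z :: "real set"
  assumes "X > 0" and gap: "\<And>c. X \<le> c \<Longrightarrow> \<exists>x\<in>{c..c + L}. x \<in> Z"
    and symm: "\<And>x. x \<in> Z \<Longrightarrow> - x \<in> Z"
  shows "closure {a / b |a b. a \<in> Z \<and> b \<in> Z \<and> \<bar>b\<bar> > 1} = UNIV"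
proof -
  have nonneg: "\<exists>a\<in>Z. \<exists>b\<in>Z. b > 1 \<and> \<bar>a / b - t\<bar> < e" if "t \<ge> 0" "e > 0" for t e
  proof -
    have "L \<ge> 0"
      using gap[of X] by force
    define B where "B = X + (X + L) / e + 2"
    have "(X + L) / e \<ge> 0"
      using \<open>X > 0\<close> \<open>L \<ge> 0\<close> \<open>e > 0\<close> by simp
    then have B: "X \<le> B" "1 < B" "(X + L) / e < B"
      unfolding B_def using \<open>X > 0\<close> by linarith+
    obtain b where b: "b \<in> Z" "B \<le> b"
      using gap[OF B(1)] by auto
    have "b > 1"
      using b B by linarith
    \<comment> \<open>Starting at t * b + X instead of t * b keeps the search in the range where
      \<open>gap\<close> applies; the resulting error of at most X + L is below e * b by the choice
      of B.\<close>
    then obtain a where a: "a \<in> Z" "t * b + X \<le> a" "a \<le> t * b + X + L"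
      using gap[of "t * b + X"] \<open>t \<ge> 0\<close> by auto
    have "(X + L) / e < b"
      using b B by linarith
    then have "X + L < e * b"
      using \<open>e > 0\<close> by (simp add: field_simps)
    then have "\<bar>a - t * b\<bar> < e * b"
      using a \<open>X > 0\<close> by linarith
    then have "\<bar>a - t * b\<bar> / b < e"
      using \<open>b > 1\<close> by (simp add: field_simps)
    moreover have "a / b - t = (a - t * b) / b"
      using \<open>b > 1\<close> by (simp add: diff_divide_distrib)
    ultimately have "\<bar>a / b - t\<bar> < e"
      using \<open>b > 1\<close> by (simp add: abs_divide)
    then show ?thesis
      using a b \<open>b > 1\<close> by blast
  qed
  have "t \<in> closure {a / b |a b. a \<in> Z \<and> b \<in> Z \<and> \<bar>b\<bar> > 1}" for t
    unfolding closure_approachable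
  proof (intro allI impI)
    fix e :: real
    assume "e > 0"
    then obtain a b where ab: "a \<in> Z" "b \<in> Z" "b > 1" "\<bar>a / b - \<bar>t\<bar>\<bar> < e"
      using nonneg[of "\<bar>t\<bar>" e] by auto
    define a' where "a' = (if t \<ge> 0 then a else - a)"
    have "a' \<in> Z"
      using ab symm by (simp add: a'_def)
    moreover have "dist (a' / b) t < e"
      using ab(4) by (auto simp: a'_def dist_real_def abs_if split: if_splits)
    ultimately show "\<exists>y\<in>{a / b |a b. a \<in> Z \<and> b \<in> Z \<and> \<bar>b\<bar> > 1}. dist y t < e"
      using ab by force
  qed
  then show ?thesis
    by blast
qed

text \<open>Baire's theorem applies to the open dense sets \<open>U N\<close> and the complements of
  the points of C. An arbitrary countable C lets the same lemma yield both density and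
  uncountability.\<close>

lemma closure_well_approximable:
  fixes Z C :: "real set"
  assumes dense: "closure {a / b |a b. a \<in> Z \<and> b \<in> Z \<and> \<bar>b\<bar> > 1} = UNIV"
    and "countable C"
  shows "closure ({x. \<forall>N::nat. \<exists>a\<in>Z. \<exists>b\<in>Z. \<bar>b\<bar> > 1 \<and> \<bar>x - a / b\<bar> < 1 / \<bar>b\<bar> ^ N} - C) = UNIV"
proof -
  define U where "U N = (\<Union>a\<in>Z. \<Union>b\<in>{b\<in>Z. \<bar>b\<bar> > 1}. ball (a / b) (1 / \<bar>b\<bar> ^ N))" for N :: nat
  let ?G = "range U \<union> (\<lambda>x. - {x}) ` C"
  have "(UNIV :: real set) \<subseteq> closure (\<Inter> ?G)"
  proof (rule Baire)
    show "countable ?G"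
      using \<open>countable C\<close> by simp
    fix T
    assume "T \<in> ?G"
    then show "openin (top_of_set UNIV) T \<and> UNIV \<subseteq> closure T"
    proof
      assume "T \<in> range U"
      then obtain N where T: "T = U N"
        by blast
      \<comment> \<open>Each quotient is the centre of a ball of positive radius in
        \<open>U N\<close>.\<close>
      have "{a / b |a b. a \<in> Z \<and> b \<in> Z \<and> \<bar>b\<bar> > 1} \<subseteq> U N"
        unfolding U_def by force
      then have "UNIV \<subseteq> closure (U N)"
        using closure_mono dense by blast
      then show ?thesis
        unfolding T by (auto simp: U_def)
    next
      assume "T \<in> (\<lambda>x. - {x}) ` C"
      then show ?thesis
        by (auto simp: closure_complement)
    qed
  qed simp
  moreover have "x \<in> U N \<longleftrightarrow> (\<exists>a\<in>Z. \<exists>b\<in>Z. \<bar>b\<bar> > 1 \<and> \<bar>x - a / b\<bar> < 1 / \<bar>b\<bar> ^ N)" for x N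
    unfolding U_def by (auto simp: dist_real_def abs_minus_commute)
  then have "\<Inter> ?G = {x. \<forall>N::nat. \<exists>a\<in>Z. \<exists>b\<in>Z. \<bar>b\<bar> > 1 \<and> \<bar>x - a / b\<bar> < 1 / \<bar>b\<bar> ^ N} - C"
    unfolding Inter_Un_distrib by auto
  ultimately show ?thesis
    by auto
qed

theorem theorem7p3:
  fixes \<nu> :: real
  shows "uncountable (bessel_Liouville_numbers \<nu>) \<and>
         closure (bessel_Liouville_numbers \<nu>) = UNIV"
proof -
  \<comment> \<open>The real zeros of j_\<nu>; the set is symmetric because x enters only through
    its square.\<close>
  define Z where "Z = {x :: real. bessel_h \<nu> (x\<^sup>2) = (0 :: real)}"
  define A where "A = {x. \<forall>N::nat. \<exists>a\<in>Z. \<exists>b\<in>Z. \<bar>b\<bar> > 1 \<and> \<bar>x - a / b\<bar> < 1 / \<bar>b\<bar> ^ N}"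
  define R where "R = {x. bessel_rational \<nu> (of_real x)}"
  have zero: "complex_of_real x \<in> bessel_zeros \<nu>" if "x \<in> Z" for x
    using that bessel_h_of_real[of \<nu> "x\<^sup>2"] by (simp add: Z_def bessel_zeros_def bessel_j_eq)
  obtain X where X: "X > 0"
    "\<And>c. X \<le> c \<Longrightarrow> \<exists>x\<in>{c..c + 2 * pi}. bessel_h \<nu> (x\<^sup>2) = (0 :: real)"
    by (rule bessel_h_square_zero[of \<nu>]) blast
  have "closure {a / b |a b. a \<in> Z \<and> b \<in> Z \<and> \<bar>b\<bar> > 1} = UNIV"
    by (rule dense_quotients[of X "2 * pi"]) (use X in \<open>simp_all add: Z_def\<close>)
  then have dense: "closure (A - C) = UNIV" if "countable C" for C
    unfolding A_def using that by (rule closure_well_approximable)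
  have sub: "A - R \<subseteq> bessel_Liouville_numbers \<nu>"
  proof
    fix x
    assume x: "x \<in> A - R"
    have "\<exists>a\<in>bessel_zeros \<nu>. \<exists>b\<in>bessel_zeros \<nu>.
        norm b > 1 \<and> norm (of_real x - a / b) < 1 / norm b ^ N" for N
    proof -
      obtain a b where ab: "a \<in> Z" "b \<in> Z" "\<bar>b\<bar> > 1" "\<bar>x - a / b\<bar> < 1 / \<bar>b\<bar> ^ N"
        using x unfolding A_def by blast
      have "norm (of_real x - of_real a / of_real b :: complex) = \<bar>x - a / b\<bar>"
        by (metis norm_of_real of_real_diff of_real_divide)
      then show ?thesis
        using ab zero by (intro bexI[of _ "of_real a"] bexI[of _ "of_real b"]) auto
    qed
    then show "x \<in> bessel_Liouville_numbers \<nu>"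
      using x unfolding bessel_Liouville_numbers_def bessel_Liouville_def R_def by simp
  qed
  have R: "countable R"
    unfolding R_def by (rule countable_bessel_rational)
  \<comment> \<open>If the Liouville numbers were countable, removing them together with R from A
    would leave a dense set; but they contain A - R, so nothing would remain.\<close>
  have "uncountable (bessel_Liouville_numbers \<nu>)"
  proof
    assume "countable (bessel_Liouville_numbers \<nu>)"
    then have "closure (A - (R \<union> bessel_Liouville_numbers \<nu>)) = UNIV"
      by (intro dense countable_Un R)
    moreover have "A - (R \<union> bessel_Liouville_numbers \<nu>) = {}"
      using sub by blast
    ultimately show False
      by simp
  qed
  moreover have "closure (bessel_Liouville_numbers \<nu>) = UNIV"
    using closure_mono[OF sub] dense[OF R] by auto
  ultimately show ?thesis
    by simp
qed

end
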